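(* Let $\mathcal{X}=[0,1]$. There is a constant $C>0$ such that for all $\varepsilon,\delta,\beta,\psi\in(0,1)$ and every $n\ge \frac{C}{\psi\varepsilon}\log\frac{1}{\beta\delta}$, the Deviating Private Algorithm (defined in the context) is $(\varepsilon,\delta)$-differentially private, and, when run on $S\sim\mu$, where $\mu$ is the measure over $\mathcal{X}^n$ with parameter $\psi$ defined in the context, it outputs a predicate $h:\mathcal{X}\to[0,1]$ such that $$\Pr\left[|h(S)-h(\mu)|\ge\frac{\psi}{2}\right]>1-\beta-\exp\left(-\frac n8\right),$$ where the probability is over $S\sim\mu$ and the coins of the algorithm.
   Context: A randomized algorithm $\mathcal{A}$ on $\mathcal{X}^n$ is $(\varepsilon,\delta)$-differentially private if for all datasets $S,S'$ differing in a single entry and all measurable sets $A$ of outputs, $\Pr[\mathcal{A}(S)\in A]\le e^{\varepsilon}\Pr[\mathcal{A}(S')\in A]+\delta$. Measure $\mu$ over $[0,1]^n$: sample $x^*$ uniformly from $[0,1]$; then independently for every $i\in[n]$ sample $\sigma_i\sim\mathrm{Ber}(\psi)$, and set $x_i=x^*$ if $\sigma_i=1$, otherwise sample $x_i$ uniformly from $[0,1]$ independently; $\mu$ is the law of $(x_1,\dots,x_n)$. Private histogram tool (a known result that may be assumed): there is an $(\varepsilon,\delta)$-differentially private algorithm $\mathcal{H}$ that takes $S\in\mathcal{X}^n$ and returns a list $L\subseteq\mathcal{X}$ such that, for every $\beta\in(0,1)$, with probability at least $1-\beta$: (1) every $x\in\mathcal{X}$ that appears at least $O\left(\frac1\varepsilon\log\frac{1}{\beta\delta}\right)$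 times in $S$ is in $L$; (2) every $x\in L$ appears at least twice in $S$. Deviating Private Algorithm: on input $S$ and $\varepsilon,\delta$, compute $L\leftarrow\mathcal{H}(S,\varepsilon,\delta)$. If $L$ is empty return $h\equiv 0$. Otherwise let $x$ be an arbitrary element of $L$ and return the indicator function $h=\mathbb{1}_{\{x\}}$. For a predicate $h$, $h(S)=\frac1n\sum_{x\in S}h(x)$ and $h(\mu)=\mathbb{E}_{T\sim\mu}[h(T)]$. *)

theory Defs
  imports "HOL-Probability.Probability"
begin

text \<open>A dataset in \<open>X\<^sup>n\<close> is a function on the index set \<open>{..<n}\<close>.\<close>

definition datasets :: "nat \<Rightarrow> 'a measure \<Rightarrow> (nat \<Rightarrow> 'a) measure" where
  "datasets n X = PiM {..<n} (\<lambda>_. X)"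

definition occurrences :: "nat \<Rightarrow> (nat \<Rightarrow> 'a) \<Rightarrow> 'a \<Rightarrow> nat" where
  "occurrences n S x = card {i \<in> {..<n}. S i = x}"

definition neighbouring :: "nat \<Rightarrow> (nat \<Rightarrow> 'a) \<Rightarrow> (nat \<Rightarrow> 'a) \<Rightarrow> bool" where
  "neighbouring n S S' \<longleftrightarrow> card {i \<in> {..<n}. S i \<noteq> S' i} = 1"

text \<open>A randomized algorithm is a Markov kernel from datasets to outputs; measurability in the
  dataset is what gives a meaning to probabilities over a random dataset.\<close>

definition differentially_private ::
  "real \<Rightarrow> real \<Rightarrow> nat \<Rightarrow> 'a measure \<Rightarrow> 'b measure \<Rightarrow> ((nat \<Rightarrow> 'a) \<Rightarrow> 'b measure) \<Rightarrow> bool" where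
  "differentially_private \<epsilon> \<delta> n X Y alg \<longleftrightarrow>
     alg \<in> datasets n X \<rightarrow>\<^sub>M prob_algebra Y \<and>
     (\<forall>S \<in> space (datasets n X). \<forall>S' \<in> space (datasets n X). neighbouring n S S' \<longrightarrow>
        (\<forall>A \<in> sets Y. measure (alg S) A \<le> exp \<epsilon> * measure (alg S') A + \<delta>))"

text \<open>The usual sigma-algebra on finite lists (the disjoint union of all finite powers).\<close>

definition list_space :: "'a measure \<Rightarrow> 'a list measure" where
  "list_space X = sigma (lists (space X))
     ({{xs \<in> lists (space X). length xs = k} | k. True} \<union>
      {{xs \<in> lists (space X). i < length xs \<and> xs ! i \<in> A} | i A. A \<in> sets X})"

text \<open>\<open>K\<close> is the constant hidden in the \<open>O\<close> of the heaviness threshold. The guarantee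
  is a property of one algorithm at one fixed \<open>(\<epsilon>, \<delta>, n)\<close>, for all \<open>\<beta>\<close> simultaneously.
  Requiring it with the same \<open>K\<close> for every \<open>\<delta> < 1\<close> would be contradictory: the threshold
  then drops to 1 or below for \<open>\<beta>\<close> and \<open>\<delta>\<close> near 1, and the two clauses conflict
  on elements that appear exactly once.\<close>

definition private_histogram ::
  "real \<Rightarrow> real \<Rightarrow> real \<Rightarrow> nat \<Rightarrow> 'a measure \<Rightarrow> ((nat \<Rightarrow> 'a) \<Rightarrow> 'a list measure) \<Rightarrow> bool" where
  "private_histogram K \<epsilon> \<delta> n X H \<longleftrightarrow>
     differentially_private \<epsilon> \<delta> n X (list_space X) H \<and>
     (\<forall>S \<in> space (datasets n X). \<forall>\<beta> \<in> {0<..<1}.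
        measure (H S)
          {L \<in> space (list_space X).
             (\<forall>x \<in> space X.
                real (occurrences n S x) \<ge> K * (1 / \<epsilon> * ln (1 / (\<beta> * \<delta>))) \<longrightarrow> x \<in> set L) \<and>
             (\<forall>x \<in> set L. occurrences n S x \<ge> 2)}
        \<ge> 1 - \<beta>)"

definition unit_interval :: "real measure" where
  "unit_interval = restrict_space borel {0..1}"

definition unit_uniform :: "real measure" where
  "unit_uniform = restrict_space lborel {0..1}"

text \<open>The measure \<open>\<mu>\<close>, sampled from \<open>x\<^sup>*\<close> and independent pairs \<open>(\<sigma>\<^sub>i, y\<^sub>i)\<close>, where
  \<open>y\<^sub>i\<close> is the fresh uniform value that is used only if \<open>\<sigma>\<^sub>i = 0\<close>.\<close>

definition planted_measure :: "nat \<Rightarrow> real \<Rightarrow> (nat \<Rightarrow> real) measure" where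
  "planted_measure n \<psi> =
     distr (unit_uniform \<Otimes>\<^sub>M
              PiM {..<n} (\<lambda>_. measure_pmf (bernoulli_pmf \<psi>) \<Otimes>\<^sub>M unit_uniform))
           (datasets n unit_interval)
           (\<lambda>(x, w). \<lambda>i\<in>{..<n}. case w i of (\<sigma>, y) \<Rightarrow> if \<sigma> then x else y)"

text \<open>Predicates \<open>[0,1] \<rightarrow> [0,1]\<close> (values off \<open>[0,1]\<close> are irrelevant), with the finest
  sigma-algebra for which \<open>x \<mapsto> \<one>\<^bsub>{x}\<^esub>\<close> is measurable. Privacy is a
  statement about all measurable sets of outputs, so it is strongest for this choice.\<close>

definition predicate_space :: "(real \<Rightarrow> real) measure" where
  "predicate_space = sigma ({0..1} \<rightarrow> {0..1})
     {A. A \<subseteq> ({0..1} \<rightarrow> {0..1}) \<and> {x \<in> {0..1}. indicat_real {x} \<in> A} \<in> sets unit_interval}"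

text \<open>The rule by which an ``arbitrary'' element of a nonempty list is taken; its value on the
  empty list is irrelevant.\<close>

definition selection_rule :: "(real list \<Rightarrow> real) \<Rightarrow> bool" where
  "selection_rule pick \<longleftrightarrow>
     pick \<in> borel_measurable (list_space unit_interval) \<and>
     (\<forall>L \<in> space (list_space unit_interval). L \<noteq> [] \<longrightarrow> pick L \<in> set L)"

definition deviating_algorithm ::
  "((nat \<Rightarrow> real) \<Rightarrow> real list measure) \<Rightarrow> (real list \<Rightarrow> real) \<Rightarrow> (nat \<Rightarrow> real) \<Rightarrow> (real \<Rightarrow> real) measure"
  where
  "deviating_algorithm H pick S =
     distr (H S) predicate_space
       (\<lambda>L. if L = [] then (\<lambda>_. 0) else indicat_real {pick L})"

definition empirical_value :: "nat \<Rightarrow> (nat \<Rightarrow> 'a) \<Rightarrow> ('a \<Rightarrow> real) \<Rightarrow> real" where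
  "empirical_value n S h = 1 / real n * (\<Sum>i<n. h (S i))"

definition expected_value :: "nat \<Rightarrow> (nat \<Rightarrow> 'a) measure \<Rightarrow> ('a \<Rightarrow> real) \<Rightarrow> real" where
  "expected_value n M h = (LINT T|M. empirical_value n T h)"

text \<open>The probability, over \<open>S\<close> drawn from \<open>M\<close> and the coins of \<open>alg\<close>, that \<open>P S h\<close> holds
  for the output \<open>h\<close> of \<open>alg\<close> on \<open>S\<close>.\<close>

definition prob_run :: "'s measure \<Rightarrow> ('s \<Rightarrow> 'h measure) \<Rightarrow> ('s \<Rightarrow> 'h \<Rightarrow> bool) \<Rightarrow> real" where
  "prob_run M alg P = (LINT S|M. measure (alg S) {h \<in> space (alg S). P S h})"

end

theory Submission
  imports Defs
begin

text \<open>
  Almost surely the fresh values are pairwise distinct, so only the planted point can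
  occur twice. By Chernoff it occurs, with high probability, at least \<open>n \<psi> / 2\<close> times, which is
  above the threshold of the histogram, and then the output is its indicator. The empirical value of that
  indicator is at least \<open>\<psi> / 2\<close>, while its expected value is 0 because each coordinate of \<open>\<mu>\<close>
  has a continuous law.
  Privacy is inherited from the histogram by postprocessing.
\<close>

subsection \<open>Measurability of the deviating algorithm\<close>

text \<open>The deterministic map from lists to predicates, named so that the algorithm is visibly a
  pushforward of the histogram.\<close>

definition singleton_predicate :: "(real list \<Rightarrow> real) \<Rightarrow> real list \<Rightarrow> real \<Rightarrow> real" where
  "singleton_predicate pick L = (if L = [] then (\<lambda>_. 0) else indicat_real {pick L})"

lemma deviating_algorithm_alt:
  "deviating_algorithm H pick S = distr (H S) predicate_space (singleton_predicate pick)"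
  unfolding deviating_algorithm_def singleton_predicate_def ..

lemma space_list_space: "space (list_space X) = lists (space X)"
  unfolding list_space_def by (rule space_measure_of) auto

lemma space_unit_interval: "space unit_interval = {0..1}"
  by (simp add: unit_interval_def space_restrict_space)

lemma space_predicate_space: "space predicate_space = ({0..1} \<rightarrow> {0..1})"
  unfolding predicate_space_def by (rule space_measure_of) auto

lemma in_sets_predicate_space:
  assumes "A \<subseteq> ({0..1} \<rightarrow> {0..1})" "{x \<in> {0..1}. indicat_real {x} \<in> A} \<in> sets unit_interval"
  shows "A \<in> sets predicate_space"
  unfolding predicate_space_def using assms by (auto simp: sets_measure_of_conv)

lemma Nil_in_sets_list_space: "{[]} \<in> sets (list_space X)"
proof -
  have "{[]} = {xs \<in> lists (space X). length xs = 0}"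
    by auto
  moreover have "{xs \<in> lists (space X). length xs = 0} \<in> sets (list_space X)"
    unfolding list_space_def by (subst sets_measure_of) (auto intro!: sigma_sets.Basic)
  ultimately show ?thesis
    by simp
qed

lemma selection_rule_in_unit_interval:
  assumes "selection_rule pick" "L \<in> space (list_space unit_interval)" "L \<noteq> []"
  shows "pick L \<in> set L" "pick L \<in> {0..1}"
  using assms by (auto simp: selection_rule_def space_list_space space_unit_interval)

text \<open>On nonempty lists, the preimage of a generator \<open>A\<close> is the preimage under
  \<open>pick\<close> of the points whose indicator lies in \<open>A\<close>; these points form a
  Borel set by the choice of generators. The empty list is an atom, treated separately.\<close>

lemma measurable_singleton_predicate:
  assumes "selection_rule pick"
  shows "singleton_predicate pick \<in> list_space unit_interval \<rightarrow>\<^sub>M predicate_space"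
  unfolding predicate_space_def
proof (rule measurable_measure_of)
  let ?L = "list_space unit_interval"
  show "singleton_predicate pick \<in> space ?L \<rightarrow> {0..1} \<rightarrow> {0..1}"
    by (auto simp: singleton_predicate_def indicator_def)
  have pick: "pick \<in> borel_measurable ?L"
    using assms by (simp add: selection_rule_def)
  fix A :: "(real \<Rightarrow> real) set"
  assume "A \<in> {A. A \<subseteq> ({0..1} \<rightarrow> {0..1}) \<and> {x \<in> {0..1}. indicat_real {x} \<in> A} \<in> sets unit_interval}"
  then have B: "{x \<in> {0..1}. indicat_real {x} \<in> A} \<in> sets unit_interval"
    by simp
  let ?B = "{x \<in> {0..1}. indicat_real {x} \<in> A}"
  have "?B \<in> sets borel"
    using B by (auto simp: unit_interval_def sets_restrict_space)
  then have P: "pick -` ?B \<inter> space ?L - {[]} \<in> sets ?L"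
    using pick Nil_in_sets_list_space by (intro sets.Diff measurable_sets) auto
  \<comment> \<open>Contribution of the empty list, which is sent to the zero predicate.\<close>
  let ?N = "if (\<lambda>_. 0) \<in> A then {[]} else {}"
  have N: "?N \<in> sets ?L"
    using Nil_in_sets_list_space by auto
  have "singleton_predicate pick -` A \<inter> space ?L = ?N \<union> (pick -` ?B \<inter> space ?L - {[]})"
    using selection_rule_in_unit_interval(2)[OF assms] sets.sets_into_space[OF Nil_in_sets_list_space]
    by (auto simp: singleton_predicate_def split: if_splits)
  then show "singleton_predicate pick -` A \<inter> space ?L \<in> sets ?L"
    using P N by (simp only:) (rule sets.Un)
qed auto

text \<open>An output event \<open>A\<close> pulls back along \<open>f\<close> to an event of the
  original algorithm, where the privacy inequality already holds.\<close>

lemma differentially_private_postprocess: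
  assumes dp: "differentially_private \<epsilon> \<delta> n X Y alg" and f: "f \<in> Y \<rightarrow>\<^sub>M Z"
  shows "differentially_private \<epsilon> \<delta> n X Z (\<lambda>S. distr (alg S) Z f)"
proof -
  have alg: "alg \<in> datasets n X \<rightarrow>\<^sub>M prob_algebra Y"
    using dp by (simp add: differentially_private_def)
  have sets: "sets (alg S) = sets Y" if "S \<in> space (datasets n X)" for S
    using measurable_space[OF alg that] by (simp add: space_prob_algebra)
  have eq: "measure (distr (alg S) Z f) A = measure (alg S) (f -` A \<inter> space Y)"
    if "S \<in> space (datasets n X)" "A \<in> sets Z" for S A
    using sets[OF that(1)] f that(2)
    by (subst measure_distr) (auto simp: sets_eq_imp_space_eq[OF sets[OF that(1)]] cong: measurable_cong_sets)
  have "(\<lambda>S. distr (alg S) Z f) \<in> datasets n X \<rightarrow>\<^sub>M prob_algebra Z"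
    using measurable_compose[OF alg measurable_distr_prob_space[OF f]] .
  then show ?thesis
    using dp measurable_sets[OF f] by (auto simp: differentially_private_def eq)
qed

section \<open>Occurrence counts and empirical values\<close>

lemma real_occurrences: "real (occurrences n S x) = (\<Sum>i<n. if S i = x then 1 else 0)"
proof -
  have "(\<Sum>i<n. if S i = x then 1 else 0 :: real) = (\<Sum>i\<in>{i \<in> {..<n}. S i = x}. 1)"
    by (rule sum.inter_filter[symmetric]) simp
  then show ?thesis
    by (simp add: occurrences_def)
qed

lemma empirical_value_singleton:
  "empirical_value n S (indicat_real {x}) = real (occurrences n S x) / real n"
  unfolding empirical_value_def real_occurrences
  by (simp add: indicator_def of_bool_def)

lemma measurable_dataset_component:
  assumes "i < n"
  shows "(\<lambda>S. S i) \<in> borel_measurable (datasets n unit_interval)"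
proof -
  have "(\<lambda>x. x) \<in> unit_interval \<rightarrow>\<^sub>M (borel :: real measure)"
    unfolding unit_interval_def by (rule measurable_restrict_space1) simp
  moreover have "(\<lambda>S. S i) \<in> datasets n unit_interval \<rightarrow>\<^sub>M unit_interval"
    unfolding datasets_def using assms by (intro measurable_component_singleton) simp
  ultimately show ?thesis
    by (rule measurable_compose[rotated])
qed

text \<open>The count is a finite sum of indicators of equalities between Borel functions. Dataset
  and point may vary together, as they do for pairs of a dataset and a list.\<close>

lemma measurable_occurrences:
  assumes f: "f \<in> M \<rightarrow>\<^sub>M datasets n unit_interval" and g: "g \<in> borel_measurable M"
  shows "(\<lambda>x. real (occurrences n (f x) (g x))) \<in> borel_measurable M"
proof -
  have "(\<lambda>x. f x i) \<in> borel_measurable M" if "i < n" for i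
    using measurable_compose[OF f measurable_dataset_component[OF that]] .
  then show ?thesis
    unfolding real_occurrences using g
    by (intro borel_measurable_sum measurable_If) (auto intro!: borel_measurable_eq)
qed

text \<open>Used to see that the set of points whose indicator deviates is finite, hence
  Borel.\<close>

lemma finite_occurrences_pos: "finite {x. 0 < occurrences n S x}"
proof (rule finite_subset)
  show "{x. 0 < occurrences n S x} \<subseteq> S ` {..<n}"
    by (auto simp: occurrences_def card_gt_0_iff)
qed simp


subsection \<open>The planted measure\<close>

lemma space_unit_uniform: "space unit_uniform = {0..1}"
  by (simp add: unit_uniform_def space_restrict_space)

lemma sets_unit_uniform: "sets unit_uniform = sets unit_interval"
  unfolding unit_uniform_def unit_interval_def by (rule sets_restrict_space_cong) simp

lemma prob_space_unit_uniform: "prob_space unit_uniform"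
  by (rule prob_spaceI) (simp add: unit_uniform_def emeasure_restrict_space space_restrict_space)

lemma AE_unit_uniform_neq: "AE x in unit_uniform. x \<noteq> c"
  unfolding unit_uniform_def using AE_lborel_singleton[of c]
  by (subst AE_restrict_space_iff) (auto elim!: eventually_mono)

lemma measurable_unit_uniform: "(\<lambda>x. x) \<in> borel_measurable unit_uniform"
  unfolding unit_uniform_def by (rule measurable_restrict_space1) simp

abbreviation coin_value :: "real \<Rightarrow> (bool \<times> real) measure" where
  "coin_value \<psi> \<equiv> measure_pmf (bernoulli_pmf \<psi>) \<Otimes>\<^sub>M unit_uniform"

abbreviation coin_values :: "nat set \<Rightarrow> real \<Rightarrow> (nat \<Rightarrow> bool \<times> real) measure" where
  "coin_values I \<psi> \<equiv> PiM I (\<lambda>_. coin_value \<psi>)"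

text \<open>The sampling map of \<open>planted_measure\<close>, named so that almost sure statements
  can be proved on the source space of coins and uniform values.\<close>

definition plant :: "nat \<Rightarrow> real \<times> (nat \<Rightarrow> bool \<times> real) \<Rightarrow> nat \<Rightarrow> real" where
  "plant n = (\<lambda>(x, w). \<lambda>i\<in>{..<n}. case w i of (\<sigma>, y) \<Rightarrow> if \<sigma> then x else y)"

lemma planted_measure_alt:
  "planted_measure n \<psi> =
     distr (unit_uniform \<Otimes>\<^sub>M coin_values {..<n} \<psi>) (datasets n unit_interval) (plant n)"
  unfolding planted_measure_def plant_def ..

lemma plant_apply: "i < n \<Longrightarrow> plant n (x, w) i = (if fst (w i) then x else snd (w i))"
  by (simp add: plant_def split: prod.split)

lemma prob_space_coin_value: "prob_space (coin_value \<psi>)"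
  by (intro prob_space_pair prob_space_unit_uniform prob_space_measure_pmf)

lemma prob_space_coin_values: "prob_space (coin_values I \<psi>)"
  by (intro prob_space_PiM prob_space_coin_value)

lemma prob_space_source: "prob_space (unit_uniform \<Otimes>\<^sub>M coin_values I \<psi>)"
  by (intro prob_space_pair prob_space_unit_uniform prob_space_coin_values)

lemma measurable_plant:
  "plant n \<in> unit_uniform \<Otimes>\<^sub>M coin_values {..<n} \<psi> \<rightarrow>\<^sub>M datasets n unit_interval"
proof -
  have id: "(\<lambda>x. x) \<in> unit_uniform \<rightarrow>\<^sub>M unit_interval"
    by (rule measurable_ident_sets) (rule sets_unit_uniform)
  have "(\<lambda>p. if fst (snd p i) then fst p else snd (snd p i))
      \<in> unit_uniform \<Otimes>\<^sub>M coin_values {..<n} \<psi> \<rightarrow>\<^sub>M unit_interval" if i: "i < n" for i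
  proof -
    have s: "(\<lambda>p. snd p i) \<in> unit_uniform \<Otimes>\<^sub>M coin_values {..<n} \<psi> \<rightarrow>\<^sub>M coin_value \<psi>"
      using i by (intro measurable_compose[OF measurable_snd]) simp
    have "(\<lambda>p. fst (snd p i)) \<in> unit_uniform \<Otimes>\<^sub>M coin_values {..<n} \<psi> \<rightarrow>\<^sub>M measure_pmf (bernoulli_pmf \<psi>)"
      by (rule measurable_compose[OF s measurable_fst])
    then have b: "Measurable.pred (unit_uniform \<Otimes>\<^sub>M coin_values {..<n} \<psi>) (\<lambda>p. fst (snd p i))"
      by (rule measurable_compose) simp
    show ?thesis
      by (intro measurable_If b[unfolded pred_def]
        measurable_compose[OF measurable_fst id]
        measurable_compose[OF s] measurable_compose[OF measurable_snd id])
  qed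
  then have "(\<lambda>p. \<lambda>i\<in>{..<n}. if fst (snd p i) then fst p else snd (snd p i))
      \<in> unit_uniform \<Otimes>\<^sub>M coin_values {..<n} \<psi> \<rightarrow>\<^sub>M datasets n unit_interval"
    unfolding datasets_def by (intro measurable_restrict) simp
  moreover have "plant n = (\<lambda>p. \<lambda>i\<in>{..<n}. if fst (snd p i) then fst p else snd (snd p i))"
    by (auto simp: plant_def case_prod_unfold)
  ultimately show ?thesis
    by simp
qed

lemma sets_planted_measure: "sets (planted_measure n \<psi>) = sets (datasets n unit_interval)"
  by (simp add: planted_measure_def)

section \<open>Marginals of products and almost sure events\<close>

lemma distr_pair_fst:
  assumes "prob_space M" "prob_space N"
  shows "distr (M \<Otimes>\<^sub>M N) M fst = M"
proof (rule measure_eqI)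
  interpret N: prob_space N by fact
  fix A assume "A \<in> sets (distr (M \<Otimes>\<^sub>M N) M fst)"
  then have A: "A \<in> sets M" by simp
  have "fst -` A \<inter> space (M \<Otimes>\<^sub>M N) = A \<times> space N"
    using sets.sets_into_space[OF A] by (auto simp: space_pair_measure)
  then show "emeasure (distr (M \<Otimes>\<^sub>M N) M fst) A = emeasure M A"
    using A by (simp add: emeasure_distr N.emeasure_pair_measure_Times N.emeasure_space_1)
qed simp

lemma distr_pair_snd:
  assumes "prob_space M" "prob_space N"
  shows "distr (M \<Otimes>\<^sub>M N) N snd = N"
proof (rule measure_eqI)
  interpret M: prob_space M by fact
  interpret N: prob_space N by fact
  fix A assume "A \<in> sets (distr (M \<Otimes>\<^sub>M N) N snd)"
  then have A: "A \<in> sets N" by simp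
  have "snd -` A \<inter> space (M \<Otimes>\<^sub>M N) = space M \<times> A"
    using sets.sets_into_space[OF A] by (auto simp: space_pair_measure)
  then show "emeasure (distr (M \<Otimes>\<^sub>M N) N snd) A = emeasure N A"
    using A by (simp add: emeasure_distr N.emeasure_pair_measure_Times M.emeasure_space_1)
qed simp

text \<open>The first marginal of the product is \<open>M\<close> itself, so null sets of
  \<open>M\<close> pull back to null sets.\<close>

lemma AE_pair_fst:
  assumes "prob_space M" "prob_space N" "AE x in M. P x"
  shows "AE p in M \<Otimes>\<^sub>M N. P (fst p)"
  by (rule AE_distrD[OF measurable_fst]) (subst distr_pair_fst[OF assms(1,2)], rule assms(3))

lemma AE_pair_snd:
  assumes "prob_space M" "prob_space N" "AE x in N. P x"
  shows "AE p in M \<Otimes>\<^sub>M N. P (snd p)"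
  by (rule AE_distrD[OF measurable_snd]) (subst distr_pair_snd[OF assms(1,2)], rule assms(3))

lemma AE_coin_value_neq: "AE p in coin_value \<psi>. snd p \<noteq> c"
  by (intro AE_pair_snd AE_unit_uniform_neq prob_space_unit_uniform prob_space_measure_pmf)

lemma AE_coin_values_component_neq:
  assumes "i \<in> I"
  shows "AE w in coin_values I \<psi>. snd (w i) \<noteq> c"
  by (rule AE_PiM_component[OF prob_space_coin_value assms AE_coin_value_neq])

lemma measurable_coin_values_value:
  assumes "i \<in> I"
  shows "(\<lambda>w. snd (w i)) \<in> borel_measurable (coin_values I \<psi>)"
  using assms
  by (intro measurable_compose[OF measurable_component_singleton]
      measurable_compose[OF measurable_snd measurable_unit_uniform])

text \<open>Split off coordinate \<open>i\<close>. Once its value is fixed, coordinate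
  \<open>j\<close> of the remaining product avoids that value almost surely; Fubini then gives the
  claim on the pair, and the law of the pair is carried back to the full product.\<close>

lemma AE_coin_values_distinct:
  assumes "i \<in> I" "j \<in> I" "i \<noteq> j"
  shows "AE w in coin_values I \<psi>. snd (w i) \<noteq> snd (w j)"
proof -
  define J where "J = I - {i}"
  have I: "I = insert i J" and j: "j \<in> J"
    using assms by (auto simp: J_def)
  let ?M = "coin_value \<psi> \<Otimes>\<^sub>M coin_values J \<psi>"
  let ?f = "\<lambda>(x, X). X(i := x)"
  interpret C: prob_space "coin_value \<psi>" by (rule prob_space_coin_value)
  interpret J: prob_space "coin_values J \<psi>" by (rule prob_space_coin_values)
  interpret pair_sigma_finite "coin_value \<psi>" "coin_values J \<psi>" ..
  have eq: "distr ?M (coin_values I \<psi>) ?f = coin_values I \<psi>"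
    unfolding I by (intro distr_pair_PiM_eq_PiM prob_space_coin_value)
  have f: "?f \<in> ?M \<rightarrow>\<^sub>M coin_values I \<psi>"
    unfolding I by measurable
  have m: "(\<lambda>p. snd (fst p)) \<in> borel_measurable ?M" "(\<lambda>p. snd (snd p j)) \<in> borel_measurable ?M"
    by (intro measurable_compose[OF measurable_fst measurable_compose[OF measurable_snd measurable_unit_uniform]]
      measurable_compose[OF measurable_snd measurable_coin_values_value] j)+
  have "AE p in ?M. snd (fst p) \<noteq> snd (snd p j)"
  proof (rule AE_pair_measure)
    show "{p \<in> space ?M. snd (fst p) \<noteq> snd (snd p j)} \<in> sets ?M"
      using m by measurable
    have "AE X in coin_values J \<psi>. snd x \<noteq> snd (X j)" for x :: "bool \<times> real"
      using AE_coin_values_component_neq[OF j, where c = "snd x" and \<psi> = \<psi>]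
      by (auto elim!: eventually_mono)
    then show "AE x in coin_value \<psi>. AE X in coin_values J \<psi>. snd (fst (x, X)) \<noteq> snd (snd (x, X) j)"
      by simp
  qed
  moreover have "{w \<in> space (coin_values I \<psi>). snd (w i) \<noteq> snd (w j)} \<in> sets (coin_values I \<psi>)"
    using measurable_coin_values_value[OF assms(1)] measurable_coin_values_value[OF assms(2)]
    by (rule borel_measurable_neq)
  ultimately have "AE w in distr ?M (coin_values I \<psi>) ?f. snd (w i) \<noteq> snd (w j)"
    using f assms(3) by (subst AE_distr_iff) (auto simp: case_prod_unfold)
  then show ?thesis
    by (simp only: eq)
qed

text \<open>Entry \<open>i\<close> is either the planted point or its fresh value, and both have a
  law without atoms.\<close>

lemma AE_planted_neq:
  assumes i: "i < n"
  shows "AE S in planted_measure n \<psi>. S i \<noteq> c"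
proof -
  let ?M = "unit_uniform \<Otimes>\<^sub>M coin_values {..<n} \<psi>"
  have "AE p in ?M. fst p \<noteq> c"
    by (intro AE_pair_fst prob_space_unit_uniform prob_space_coin_values AE_unit_uniform_neq)
  moreover have "AE p in ?M. snd (snd p i) \<noteq> c"
    using i by (intro AE_pair_snd[where P = "\<lambda>w. snd (w i) \<noteq> c"] prob_space_unit_uniform
      prob_space_coin_values AE_coin_values_component_neq) simp
  ultimately have "AE p in ?M. plant n p i \<noteq> c"
  proof eventually_elim
    case (elim p)
    then show ?case
      using i by (cases p) (simp add: plant_apply)
  qed
  moreover have "{S \<in> space (datasets n unit_interval). S i \<noteq> c} \<in> sets (datasets n unit_interval)"
    using measurable_dataset_component[OF i] by measurable
  ultimately show ?thesis
    unfolding planted_measure_alt by (subst AE_distr_iff) (auto intro: measurable_plant)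
qed

text \<open>Almost surely none of the finitely many entries equals \<open>c\<close>, so the
  empirical value vanishes almost everywhere.\<close>

lemma expected_value_singleton: "expected_value n (planted_measure n \<psi>) (indicat_real {c}) = 0"
proof -
  have "AE S in planted_measure n \<psi>. \<forall>i\<in>{..<n}. S i \<noteq> c"
    by (intro AE_finite_allI AE_planted_neq) auto
  then show ?thesis
    unfolding expected_value_def
    by (intro integral_eq_zero_AE) (auto simp: empirical_value_def elim!: eventually_mono)
qed

section \<open>Repeated entries of a planted dataset\<close>

text \<open>Two positions share the value \<open>y\<close>. If either of them holds the planted
  point, then \<open>y\<close> is that point; otherwise two fresh values would coincide.\<close>

lemma planted_point_unique:
  assumes distinct: "\<And>i j. i < n \<Longrightarrow> j < n \<Longrightarrow> i \<noteq> j \<Longrightarrow> snd (w i) \<noteq> snd (w j)"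
    and y: "occurrences n (plant n (x, w)) y \<ge> 2"
  shows "y = x"
proof -
  have "2 \<le> card {i \<in> {..<n}. plant n (x, w) i = y}"
    using y by (simp add: occurrences_def)
  then obtain i j where "i < n" "j < n" "i \<noteq> j" "plant n (x, w) i = y" "plant n (x, w) j = y"
    using card_le_Suc0_iff_eq[of "{i \<in> {..<n}. plant n (x, w) i = y}"] by auto
  then show ?thesis
    using distinct[of i j] by (auto simp: plant_apply split: if_splits)
qed

text \<open>Only an inequality, since a fresh value may happen to equal \<open>x\<close>.\<close>

lemma count_le_occurrences_plant:
  "card {i \<in> {..<n}. fst (w i)} \<le> occurrences n (plant n (x, w)) x"
  unfolding occurrences_def by (rule card_mono) (auto simp: plant_apply)

section \<open>Lower tail of the number of planted entries\<close>

lemma prod_half_power: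
  fixes n :: nat
  shows "(\<Prod>i<n. if P i then 1 / 2 else 1 :: real) = (1 / 2) ^ card {i \<in> {..<n}. P i}"
proof -
  have "(\<Prod>i<n. if P i then 1 / 2 else 1 :: real) = (\<Prod>i\<in>{i \<in> {..<n}. P i}. 1 / 2)"
    by (rule prod.inter_filter[OF finite_lessThan, symmetric])
  then show ?thesis
    by simp
qed

lemma measurable_coin_fst: "Measurable.pred (coin_value \<psi>) fst"
  by (rule measurable_compose[OF measurable_fst]) simp

lemma integral_coin_value:
  fixes f :: "bool \<Rightarrow> real"
  assumes "\<psi> \<in> {0<..<1}"
  shows "(LINT p|coin_value \<psi>. f (fst p)) = f True * \<psi> + f False * (1 - \<psi>)"
proof -
  have "(LINT p|coin_value \<psi>. f (fst p)) =
      (LINT b|distr (coin_value \<psi>) (measure_pmf (bernoulli_pmf \<psi>)) fst. f b)"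
    by (rule integral_distr[symmetric]) simp_all
  also have "\<dots> = (LINT b|measure_pmf (bernoulli_pmf \<psi>). f b)"
    by (simp only: distr_pair_fst[OF prob_space_measure_pmf prob_space_unit_uniform])
  finally show ?thesis
    using assms by simp
qed

text \<open>The count is a measurable sum of natural numbers into a discrete space, so
  \<open>Q\<close> can be arbitrary.\<close>

lemma sets_count:
  "{w \<in> space (coin_values {..<n} \<psi>). Q (card {i \<in> {..<n}. fst (w i)})} \<in> sets (coin_values {..<n} \<psi>)"
proof -
  have "Measurable.pred (coin_values {..<n} \<psi>) (\<lambda>w. fst (w i))" if "i < n" for i
    using that by (intro measurable_compose[OF measurable_component_singleton[where M = "\<lambda>_. coin_value \<psi>"] measurable_coin_fst]) simp
  then have "(\<lambda>w. \<Sum>i<n. if fst (w i) then 1 else 0 :: nat) \<in> coin_values {..<n} \<psi> \<rightarrow>\<^sub>M count_space UNIV"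
    by (intro measurable_sum_nat measurable_If) auto
  moreover have "(\<Sum>i<n. if fst (w i) then 1 else 0 :: nat) = card {i \<in> {..<n}. fst (w i)}"
    for w :: "nat \<Rightarrow> bool \<times> real"
    by (simp add: sum.inter_filter[symmetric])
  ultimately show ?thesis
    by (simp add: measurable_sets_Collect)
qed

text \<open>Chernoff's method applied to \<open>2\<^bsup>-X\<^esup>\<close>, where \<open>X\<close> is the number of planted entries.\<close>

lemma count_tail_bound:
  assumes \<psi>: "\<psi> \<in> {0<..<1}"
  shows "measure (coin_values {..<n} \<psi>) {w \<in> space (coin_values {..<n} \<psi>).
     real (card {i \<in> {..<n}. fst (w i)}) < real n * \<psi> / 2} \<le> exp (- real n * \<psi> / 8)"
proof -
  let ?M = "coin_values {..<n} \<psi>"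
  let ?c = "\<lambda>b. if b then 1 / 2 else 1 :: real"
  let ?f = "\<lambda>w. \<Prod>i<n. ?c (fst (w i))"
  \<comment> \<open>This is 2 to the power \<open>- n * \<psi> / 2\<close>: having fewer than
    \<open>n * \<psi> / 2\<close> planted entries forces \<open>?f\<close> above \<open>a\<close>,
    which sets up Markov's inequality.\<close>
  define a where "a = exp (- ln 2 * (real n * \<psi> / 2))"
  interpret C: prob_space "coin_value \<psi>" by (rule prob_space_coin_value)
  interpret M: prob_space ?M by (rule prob_space_coin_values)
  interpret P: product_sigma_finite "\<lambda>_ :: nat. coin_value \<psi>" ..
  have meas: "(\<lambda>p. ?c (fst p)) \<in> borel_measurable (coin_value \<psi>)"
    using measurable_coin_fst by (intro measurable_If) auto
  have int: "integrable (coin_value \<psi>) (\<lambda>p. ?c (fst p))"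
    using meas by (intro C.integrable_const_bound[of _ 1]) auto
  have "(LINT w|?M. ?f w) = (\<Prod>i<n. LINT p|coin_value \<psi>. ?c (fst p))"
    by (rule P.product_integral_prod) (use int in auto)
  \<comment> \<open>Each factor has mean \<open>\<psi> / 2 + (1 - \<psi>)\<close>.\<close>
  also have "\<dots> = (1 - \<psi> / 2) ^ n"
    using integral_coin_value[OF \<psi>, of ?c] by simp
  also have "\<dots> \<le> exp (- \<psi> / 2) ^ n"
    using \<psi> exp_ge_add_one_self[of "- \<psi> / 2"] by (intro power_mono) auto
  finally have E: "(LINT w|?M. ?f w) \<le> exp (- real n * \<psi> / 2)"
    by (simp add: exp_of_nat_mult[symmetric])
  have intf: "integrable ?M ?f"
    by (rule P.product_integrable_prod) (use int in auto)
  have half: "(1 / 2 :: real) ^ k = exp (- ln 2 * real k)" for k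
    by (simp add: exp_minus exp_of_nat2_mult power_one_over inverse_eq_divide)
  have "measure ?M {w \<in> space ?M. real (card {i \<in> {..<n}. fst (w i)}) < real n * \<psi> / 2}
      \<le> measure ?M {w \<in> space ?M. a \<le> ?f w}"
  proof (rule M.finite_measure_mono)
    show "{w \<in> space ?M. real (card {i \<in> {..<n}. fst (w i)}) < real n * \<psi> / 2}
        \<subseteq> {w \<in> space ?M. a \<le> ?f w}"
      by (auto simp: prod_half_power half a_def)
    show "{w \<in> space ?M. a \<le> ?f w} \<in> sets ?M"
      using borel_measurable_integrable[OF intf] by measurable
  qed
  also have "\<dots> \<le> (LINT w|?M. ?f w) / a"
    by (rule integral_Markov_inequality_measure[OF intf, where A = "{}"])
       (auto simp: a_def intro!: prod_nonneg)
  also have "\<dots> \<le> exp (- real n * \<psi> / 2) / a"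
    using E by (simp add: divide_right_mono a_def)
  also have "\<dots> = exp (- real n * \<psi> * ((1 - ln 2) / 2))"
    by (simp add: a_def exp_diff[symmetric] field_simps)
  also have "\<dots> \<le> exp (- real n * \<psi> / 8)"
  proof -
    \<comment> \<open>From \<open>ln 2\<close> at most 25/36, the right side is at least 11/72,
      which exceeds 9/72.\<close>
    have "1 / 8 \<le> (1 - ln 2) / (2 :: real)"
      using ln2_le_25_over_36 by simp
    then have "real n * \<psi> * (1 / 8) \<le> real n * \<psi> * ((1 - ln 2) / 2)"
      using \<psi> by (intro mult_left_mono) auto
    then show ?thesis
      by simp
  qed
  finally show ?thesis .
qed


subsection \<open>Accuracy of the deviating algorithm\<close>

text \<open>If the threshold were at most 1, then both clauses of the guarantee would conflict on an
  entry that occurs exactly once. The resulting lower bound on \<open>n \<psi>\<close> is what makes the Chernoff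
  bound useful when \<open>\<beta>\<close> and \<open>\<delta>\<close> are close to 1.\<close>

lemma private_histogram_threshold_gt_1:
  assumes H: "private_histogram K \<epsilon> \<delta> n unit_interval H"
    and n: "0 < n" and \<beta>: "\<beta> \<in> {0<..<1}"
  shows "1 < K * (1 / \<epsilon> * ln (1 / (\<beta> * \<delta>)))"
proof (rule ccontr)
  assume le: "\<not> 1 < K * (1 / \<epsilon> * ln (1 / (\<beta> * \<delta>)))"
  \<comment> \<open>One entry is 1 and all others are 0, so the value 1 occurs exactly once and no
    list can satisfy both clauses.\<close>
  define S :: "nat \<Rightarrow> real" where "S = (\<lambda>i\<in>{..<n}. if i = 0 then 1 else 0)"
  have S: "S \<in> space (datasets n unit_interval)"
    by (auto simp: S_def datasets_def space_PiM space_unit_interval)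
  have "{i \<in> {..<n}. S i = 1} = {0}"
    using n by (auto simp: S_def split: if_splits)
  then have occ: "occurrences n S 1 = 1"
    by (simp add: occurrences_def)
  have "{L \<in> space (list_space unit_interval).
             (\<forall>x \<in> space unit_interval.
                real (occurrences n S x) \<ge> K * (1 / \<epsilon> * ln (1 / (\<beta> * \<delta>))) \<longrightarrow> x \<in> set L) \<and>
             (\<forall>x \<in> set L. occurrences n S x \<ge> 2)} = {}" (is "?G = {}")
    using le occ by (force simp: space_unit_interval dest!: bspec[of "{0..1}" _ 1])
  then have "measure (H S) ?G = 0"
    by (simp only: measure_empty)
  moreover have "1 - \<beta> \<le> measure (H S) ?G"
    using H S \<beta> unfolding private_histogram_def by blast
  ultimately have "1 - \<beta> \<le> 0"
    by (simp only:)
  then show False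
    using \<beta> by simp
qed

text \<open>Indicators of points have expected value 0, so deviating means that the picked point is
  heavy. The event must be shown measurable in \<open>predicate_space\<close>, as
  \<open>measure\<close> is 0 by default on other sets.\<close>

lemma measure_deviating_algorithm:
  assumes H: "H \<in> datasets n unit_interval \<rightarrow>\<^sub>M prob_algebra (list_space unit_interval)"
    and pick: "selection_rule pick" and n: "0 < n" and \<psi>: "0 < \<psi>"
    and S: "S \<in> space (datasets n unit_interval)"
  shows "measure (deviating_algorithm H pick S)
      {h \<in> space (deviating_algorithm H pick S).
         \<bar>empirical_value n S h - expected_value n (planted_measure n \<psi>) h\<bar> \<ge> \<psi> / 2} =
    measure (H S) {L \<in> space (list_space unit_interval).
         L \<noteq> [] \<and> real n * \<psi> / 2 \<le> real (occurrences n S (pick L))}"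
    (is "measure ?A {h \<in> space ?A. ?P h} = measure _ ?B")
proof -
  have sets: "sets (H S) = sets (list_space unit_interval)"
    using measurable_space[OF H S] by (simp add: space_prob_algebra)
  note space = sets_eq_imp_space_eq[OF sets]
  have P: "?P (indicat_real {x}) \<longleftrightarrow> real n * \<psi> / 2 \<le> real (occurrences n S x)" for x
    using n by (simp add: empirical_value_singleton expected_value_singleton field_simps)
  have P0: "\<not> ?P (\<lambda>_. 0)"
    using \<psi> by (simp add: empirical_value_def expected_value_def)
  have A: "space ?A = space predicate_space"
    by (simp add: deviating_algorithm_def)
  \<comment> \<open>A deviating indicator belongs to a point that occurs in \<open>S\<close>, which
    leaves finitely many candidates.\<close>
  have "finite {x \<in> {0..1}. indicat_real {x} \<in> {h \<in> space predicate_space. ?P h}}"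
  proof (rule finite_subset)
    show "{x \<in> {0..1}. indicat_real {x} \<in> {h \<in> space predicate_space. ?P h}} \<subseteq> {x. 0 < occurrences n S x}"
    proof safe
      fix x assume "?P (indicat_real {x})"
      then have "real n * \<psi> / 2 \<le> real (occurrences n S x)"
        by (simp only: P)
      moreover have "0 < real n * \<psi> / 2"
        using n \<psi> by simp
      ultimately show "0 < occurrences n S x"
        by linarith
    qed
  qed (rule finite_occurrences_pos)
  then have "{x \<in> {0..1}. indicat_real {x} \<in> {h \<in> space predicate_space. ?P h}} \<in> sets unit_interval"
    unfolding unit_interval_def
    by (subst sets_restrict_space_iff) (auto intro: borel_closed finite_imp_closed)
  then have "{h \<in> space predicate_space. ?P h} \<in> sets predicate_space"
    by (intro in_sets_predicate_space) (auto simp: space_predicate_space)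
  moreover have "singleton_predicate pick \<in> H S \<rightarrow>\<^sub>M predicate_space"
    using measurable_singleton_predicate[OF pick] by (simp cong: measurable_cong_sets add: sets)
  ultimately have "measure ?A {h \<in> space ?A. ?P h} =
      measure (H S) (singleton_predicate pick -` {h \<in> space predicate_space. ?P h} \<inter> space (H S))"
    unfolding A unfolding deviating_algorithm_alt by (intro measure_distr)
  also have "singleton_predicate pick -` {h \<in> space predicate_space. ?P h} \<inter> space (H S) = ?B"
  proof -
    have "singleton_predicate pick L \<in> space predicate_space" if "L \<in> space (list_space unit_interval)" for L
      using measurable_space[OF measurable_singleton_predicate[OF pick] that] .
    moreover have "?P (singleton_predicate pick L) \<longleftrightarrow> L \<noteq> [] \<and> real n * \<psi> / 2 \<le> real (occurrences n S (pick L))" for L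
      unfolding singleton_predicate_def using P P0 by (cases "L = []") (simp_all only: if_True if_False simp_thms)
    ultimately show ?thesis
      unfolding space by blast
  qed
  finally show ?thesis .
qed

text \<open>Joint measurability of the event in dataset and list makes its probability under the
  kernel measurable in the dataset. This permits the change of variables along
  \<open>plant\<close>.\<close>

lemma measurable_heavy_pick:
  assumes H: "H \<in> datasets n unit_interval \<rightarrow>\<^sub>M prob_algebra (list_space unit_interval)"
    and pick: "selection_rule pick"
  shows "(\<lambda>S. measure (H S) {L \<in> space (list_space unit_interval).
       L \<noteq> [] \<and> c \<le> real (occurrences n S (pick L))}) \<in> borel_measurable (datasets n unit_interval)"
proof (rule measure_measurable_prob_algebra2[OF _ H])
  let ?M = "datasets n unit_interval \<Otimes>\<^sub>M list_space unit_interval"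
  have "(\<lambda>p. pick (snd p)) \<in> borel_measurable ?M"
    using pick by (intro measurable_compose[OF measurable_snd]) (simp add: selection_rule_def)
  then have "(\<lambda>p. real (occurrences n (fst p) (pick (snd p)))) \<in> borel_measurable ?M"
    by (rule measurable_occurrences[OF measurable_fst])
  then have "{p \<in> space ?M. c \<le> real (occurrences n (fst p) (pick (snd p)))} \<in> sets ?M"
    by measurable
  moreover have "snd -` {[]} \<inter> space ?M \<in> sets ?M"
    by (rule measurable_sets[OF measurable_snd Nil_in_sets_list_space])
  ultimately have "{p \<in> space ?M. c \<le> real (occurrences n (fst p) (pick (snd p)))} - (snd -` {[]} \<inter> space ?M) \<in> sets ?M"
    by (rule sets.Diff)
  also have "{p \<in> space ?M. c \<le> real (occurrences n (fst p) (pick (snd p)))} - (snd -` {[]} \<inter> space ?M) =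
      (SIGMA S : space (datasets n unit_interval). {L \<in> space (list_space unit_interval).
        L \<noteq> [] \<and> c \<le> real (occurrences n S (pick L))})"
    by (auto simp: space_pair_measure)
  finally show "(SIGMA S : space (datasets n unit_interval). {L \<in> space (list_space unit_interval).
        L \<noteq> [] \<and> c \<le> real (occurrences n S (pick L))}) \<in> sets ?M" .
qed

text \<open>On the histogram's good event the list contains \<open>x\<close>, hence is nonempty, and
  every listed point occurs twice, hence equals \<open>x\<close>. Any selection rule must therefore
  return \<open>x\<close>.\<close>

lemma heavy_pick_ge:
  assumes H: "private_histogram K \<epsilon> \<delta> n unit_interval H" and pick: "selection_rule pick"
    and S: "S \<in> space (datasets n unit_interval)" and \<beta>: "\<beta> \<in> {0<..<1}"
    and x: "x \<in> {0..1}" "c \<le> real (occurrences n S x)"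
    and c: "K * (1 / \<epsilon> * ln (1 / (\<beta> * \<delta>))) \<le> c"
    and unique: "\<And>y. 2 \<le> occurrences n S y \<Longrightarrow> y = x"
  shows "1 - \<beta> \<le> measure (H S) {L \<in> space (list_space unit_interval).
       L \<noteq> [] \<and> c \<le> real (occurrences n S (pick L))}" (is "_ \<le> measure _ ?B")
proof -
  let ?G = "{L \<in> space (list_space unit_interval).
             (\<forall>x \<in> space unit_interval.
                real (occurrences n S x) \<ge> K * (1 / \<epsilon> * ln (1 / (\<beta> * \<delta>))) \<longrightarrow> x \<in> set L) \<and>
             (\<forall>x \<in> set L. occurrences n S x \<ge> 2)}"
  have G: "1 - \<beta> \<le> measure (H S) ?G"
    using H S \<beta> unfolding private_histogram_def by blast
  have Hm: "H \<in> datasets n unit_interval \<rightarrow>\<^sub>M prob_algebra (list_space unit_interval)"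
    using H by (simp add: private_histogram_def differentially_private_def)
  have sets: "sets (H S) = sets (list_space unit_interval)" and "prob_space (H S)"
    using measurable_space[OF Hm S] by (simp_all add: space_prob_algebra)
  then interpret prob_space "H S" by simp
  have sub: "?G \<subseteq> ?B"
  proof
    fix L assume L: "L \<in> ?G"
    then have "x \<in> set L"
      using x c by (force simp: space_unit_interval)
    then have ne: "L \<noteq> []"
      by auto
    then have "pick L \<in> set L"
      using L selection_rule_in_unit_interval(1)[OF pick] by blast
    then have "pick L = x"
      using L unique by blast
    then show "L \<in> ?B"
      using L ne x by simp
  qed
  have "?B \<in> sets (H S)"
  proof -
    have p: "pick \<in> borel_measurable (list_space unit_interval)"
      using pick by (simp add: selection_rule_def)
    have "(\<lambda>L. real (occurrences n S (pick L))) \<in> borel_measurable (list_space unit_interval)"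
      using S by (intro measurable_occurrences p) simp
    then have "{L \<in> space (list_space unit_interval). c \<le> real (occurrences n S (pick L))} - {[]}
        \<in> sets (list_space unit_interval)"
      by (intro sets.Diff borel_measurable_le Nil_in_sets_list_space) simp_all
    moreover have "{L \<in> space (list_space unit_interval). c \<le> real (occurrences n S (pick L))} - {[]} = ?B"
      by auto
    ultimately show ?thesis
      by (simp add: sets)
  qed
  from finite_measure_mono[OF sub this] G show ?thesis
    by simp
qed

text \<open>The product form arises because the histogram succeeds with probability at least
  \<open>1 - \<beta>\<close> on almost every dataset whose coins are good, and the coins are good
  with the probability given by the Chernoff bound.\<close>

lemma prob_run_deviating_ge:
  assumes H: "private_histogram K \<epsilon> \<delta> n unit_interval H" and pick: "selection_rule pick"
    and n: "0 < n" and \<psi>: "\<psi> \<in> {0<..<1}" and \<beta>: "\<beta> \<in> {0<..<1}"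
    and c: "K * (1 / \<epsilon> * ln (1 / (\<beta> * \<delta>))) \<le> real n * \<psi> / 2"
  shows "(1 - \<beta>) * (1 - exp (- real n * \<psi> / 8)) \<le>
     prob_run (planted_measure n \<psi>) (deviating_algorithm H pick)
         (\<lambda>S h. \<bar>empirical_value n S h - expected_value n (planted_measure n \<psi>) h\<bar> \<ge> \<psi> / 2)"
    (is "_ \<le> ?run")
proof -
  let ?C = "coin_values {..<n} \<psi>"
  let ?M = "unit_uniform \<Otimes>\<^sub>M ?C"
  define g where "g = (\<lambda>S. measure (H S) {L \<in> space (list_space unit_interval).
         L \<noteq> [] \<and> real n * \<psi> / 2 \<le> real (occurrences n S (pick L))})"
  let ?bad = "{w \<in> space ?C. real (card {i \<in> {..<n}. fst (w i)}) < real n * \<psi> / 2}"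
  let ?E = "snd -` (space ?C - ?bad) \<inter> space ?M"
  interpret C: prob_space ?C by (rule prob_space_coin_values)
  interpret M: prob_space ?M by (rule prob_space_source)
  have Hm: "H \<in> datasets n unit_interval \<rightarrow>\<^sub>M prob_algebra (list_space unit_interval)"
    using H by (simp add: private_histogram_def differentially_private_def)
  have g: "g \<in> borel_measurable (datasets n unit_interval)"
    unfolding g_def by (rule measurable_heavy_pick[OF Hm pick])
  have g1: "0 \<le> g S" "g S \<le> 1" if "S \<in> space (datasets n unit_interval)" for S
    using measurable_space[OF Hm that] by (auto simp: g_def space_prob_algebra prob_space.prob_le_1)
  have bad: "?bad \<in> sets ?C"
    by (rule sets_count)
  then have E: "?E \<in> sets ?M"
    by (intro measurable_sets[OF measurable_snd]) auto
  have "measure ?M ?E = measure (distr ?M ?C snd) (space ?C - ?bad)"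
    using bad by (intro measure_distr[symmetric]) auto
  also have "\<dots> = 1 - measure ?C ?bad"
    unfolding distr_pair_snd[OF prob_space_unit_uniform prob_space_coin_values]
    by (rule C.prob_compl[OF bad])
  also have "\<dots> \<ge> 1 - exp (- real n * \<psi> / 8)"
    using count_tail_bound[OF \<psi>, of n] by simp
  finally have "(1 - \<beta>) * (1 - exp (- real n * \<psi> / 8)) \<le> (1 - \<beta>) * measure ?M ?E"
    using \<beta> by (intro mult_left_mono) auto
  \<comment> \<open>Written as an integral, the bound reduces to an almost everywhere comparison
    with the conditional success probability \<open>g\<close>.\<close>
  also have "\<dots> = (LINT p|?M. (1 - \<beta>) * indicat_real ?E p)"
    using E by simp
  also have "\<dots> \<le> (LINT p|?M. g (plant n p))"
  proof (rule integral_mono_AE)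
    show "integrable ?M (\<lambda>p. (1 - \<beta>) * indicat_real ?E p)"
      using E by (intro integrable_mult_right integrable_real_indicator) (auto simp: M.emeasure_eq_measure)
    show "integrable ?M (\<lambda>p. g (plant n p))"
      using g1 measurable_space[OF measurable_plant] measurable_compose[OF measurable_plant g]
      by (intro M.integrable_const_bound[of _ 1] AE_I2) auto
    have "AE w in ?C. \<forall>i\<in>{..<n}. \<forall>j\<in>{..<n}. i \<noteq> j \<longrightarrow> snd (w i) \<noteq> snd (w j)"
      by (intro AE_finite_allI AE_impI AE_coin_values_distinct) auto
    then have "AE p in ?M. \<forall>i\<in>{..<n}. \<forall>j\<in>{..<n}. i \<noteq> j \<longrightarrow> snd (snd p i) \<noteq> snd (snd p j)"
      by (rule AE_pair_snd[OF prob_space_unit_uniform prob_space_coin_values])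
    then show "AE p in ?M. (1 - \<beta>) * indicat_real ?E p \<le> g (plant n p)"
      using AE_space
    proof eventually_elim
      case (elim p)
      obtain x w where p: "p = (x, w)"
        by (cases p)
      have S: "plant n p \<in> space (datasets n unit_interval)"
        using measurable_space[OF measurable_plant elim(2)] .
      show ?case
      proof (cases "p \<in> ?E")
        case True
        have "1 - \<beta> \<le> g (plant n p)"
          unfolding g_def
        proof (rule heavy_pick_ge[OF H pick S \<beta> _ _ c])
          show "x \<in> {0..1}"
            using elim(2) by (simp add: p space_pair_measure space_unit_uniform)
          have "real n * \<psi> / 2 \<le> real (card {i \<in> {..<n}. fst (w i)})"
            using True by (auto simp: p)
          then show "real n * \<psi> / 2 \<le> real (occurrences n (plant n p) x)"
            using count_le_occurrences_plant[of n w x] unfolding p by linarith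
          show "y = x" if "2 \<le> occurrences n (plant n p) y" for y
            using planted_point_unique[of n w x y] elim(1) that by (auto simp: p)
        qed
        then show ?thesis
          using True by simp
      next
        case False
        then show ?thesis
          using g1(1)[OF S] by simp
      qed
    qed
  qed
  also have "\<dots> = (LINT S|planted_measure n \<psi>. g S)"
    unfolding planted_measure_alt by (rule integral_distr[OF measurable_plant g, symmetric])
  also have "\<dots> = ?run"
    unfolding prob_run_def g_def
    by (rule Bochner_Integration.integral_cong[OF refl], rule measure_deviating_algorithm[OF Hm pick n, symmetric])
       (use \<psi> in \<open>auto simp: sets_eq_imp_space_eq[OF sets_planted_measure]\<close>)
  finally show ?thesis .
qed

text \<open>The histogram guarantee is used with failure probability \<open>\<beta>\<^sup>2\<close>, which
  leaves room for the failure probability \<open>\<beta> / 2\<close> of the Chernoff bound even as \<open>\<beta>\<close> tends to 1.\<close>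

theorem lemma3p5:
  fixes K :: real
  assumes "K > 0"
  shows "\<exists>C > 0. \<forall>\<epsilon> \<in> {0<..<1}. \<forall>\<delta> \<in> {0<..<1}. \<forall>\<beta> \<in> {0<..<1}. \<forall>\<psi> \<in> {0<..<1}. \<forall>n :: nat.
    real n \<ge> C / (\<psi> * \<epsilon>) * ln (1 / (\<beta> * \<delta>)) \<longrightarrow>
    (\<forall>H pick. private_histogram K \<epsilon> \<delta> n unit_interval H \<and> selection_rule pick \<longrightarrow>
       differentially_private \<epsilon> \<delta> n unit_interval predicate_space (deviating_algorithm H pick) \<and>
       prob_run (planted_measure n \<psi>) (deviating_algorithm H pick)
         (\<lambda>S h. \<bar>empirical_value n S h - expected_value n (planted_measure n \<psi>) h\<bar> \<ge> \<psi> / 2)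
       > 1 - \<beta> - exp (- real n / 8))"
\<comment> \<open>With \<open>l\<close> the scaled logarithm, the \<open>K\<close> part of the
  constant puts the threshold for \<open>\<beta>\<^sup>2\<close>, at most \<open>2 * K * l\<close>,
  below \<open>n * \<psi> / 2\<close>. The added 1 supplies an extra \<open>l\<close> above
  \<open>- ln \<beta>\<close> for the tail bound.\<close>
proof (intro exI[of _ "8 * (K + 1)"] conjI ballI allI impI)
  show "0 < 8 * (K + 1)"
    using assms by simp
  fix \<epsilon> \<delta> \<beta> \<psi> :: real and n :: nat and H :: "(nat \<Rightarrow> real) \<Rightarrow> real list measure" and pick :: "real list \<Rightarrow> real"
  assume \<epsilon>: "\<epsilon> \<in> {0<..<1}" and \<delta>: "\<delta> \<in> {0<..<1}" and \<beta>: "\<beta> \<in> {0<..<1}" and \<psi>: "\<psi> \<in> {0<..<1}"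
    and n: "real n \<ge> 8 * (K + 1) / (\<psi> * \<epsilon>) * ln (1 / (\<beta> * \<delta>))"
    and HP: "private_histogram K \<epsilon> \<delta> n unit_interval H \<and> selection_rule pick"
  then have H: "private_histogram K \<epsilon> \<delta> n unit_interval H" and pick: "selection_rule pick"
    by auto
  have "differentially_private \<epsilon> \<delta> n unit_interval (list_space unit_interval) H"
    using H by (simp add: private_histogram_def)
  from differentially_private_postprocess[OF this measurable_singleton_predicate[OF pick]]
  show "differentially_private \<epsilon> \<delta> n unit_interval predicate_space (deviating_algorithm H pick)"
    by (simp add: deviating_algorithm_alt[abs_def])
  define l where "l = 1 / \<epsilon> * ln (1 / (\<beta> * \<delta>))"
  have bd: "0 < \<beta> * \<delta>" "\<beta> * \<delta> < \<beta>"
    using \<beta> \<delta> by auto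
  have ln_bd: "ln (1 / (\<beta> * \<delta>)) = - ln \<beta> - ln \<delta>"
    using \<beta> \<delta> by (simp add: ln_div ln_mult)
  have neg: "ln \<beta> < 0" "ln \<delta> < 0"
    using \<beta> \<delta> by auto
  have "ln (1 / (\<beta> * \<delta>)) \<le> l"
    using \<epsilon> neg mult_right_mono[of 1 "1 / \<epsilon>" "ln (1 / (\<beta> * \<delta>))"] unfolding l_def ln_bd by simp
  then have l: "- ln \<beta> < l"
    using neg unfolding ln_bd by simp
  then have l0: "0 < l"
    using neg by simp
  have n\<psi>: "8 * (K + 1) * l \<le> real n * \<psi>"
    using n \<epsilon> \<psi> unfolding l_def by (simp add: field_simps)
  have "0 < real n * \<psi>"
    using n\<psi> l0 assms by (intro less_le_trans[OF _ n\<psi>]) simp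
  then have n0: "0 < n"
    by (cases n) auto
  \<comment> \<open>The constant 1 gained here turns the tail bound from \<open>\<beta>\<close> into
    at most \<open>\<beta> / 2\<close>.\<close>
  have "1 < K * l"
    using private_histogram_threshold_gt_1[OF H n0 \<beta>] by (simp add: l_def)
  then have "1 - ln \<beta> \<le> (K + 1) * l"
    using l by (simp add: algebra_simps)
  then have "1 - ln \<beta> \<le> real n * \<psi> / 8"
    using n\<psi> by linarith
  then have "exp (- real n * \<psi> / 8) \<le> exp (ln \<beta> - ln 2)"
    using ln_2_less_1 by simp
  also have "\<dots> = \<beta> / 2"
    using \<beta> by (simp add: exp_diff)
  finally have tail: "exp (- real n * \<psi> / 8) \<le> \<beta> / 2" .
  have \<beta>2: "\<beta>\<^sup>2 \<in> {0<..<1}"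
    using \<beta> by (auto simp: power_less_one_iff)
  \<comment> \<open>Squaring doubles only the \<open>\<beta>\<close> part of the logarithm, and the
    \<open>\<delta>\<close> part is positive.\<close>
  have "ln (1 / (\<beta>\<^sup>2 * \<delta>)) \<le> 2 * ln (1 / (\<beta> * \<delta>))"
    using \<beta> \<delta> neg unfolding ln_bd by (simp add: ln_div ln_mult ln_realpow)
  then have "1 / \<epsilon> * ln (1 / (\<beta>\<^sup>2 * \<delta>)) \<le> 2 * l"
    using \<epsilon> unfolding l_def by (simp add: divide_right_mono field_simps)
  then have "K * (1 / \<epsilon> * ln (1 / (\<beta>\<^sup>2 * \<delta>))) \<le> K * (2 * l)"
    using assms by (intro mult_left_mono) auto
  also have "\<dots> \<le> real n * \<psi> / 2"
    using n\<psi> l0 mult_pos_pos[OF assms l0] by (simp add: algebra_simps)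
  finally have c: "K * (1 / \<epsilon> * ln (1 / (\<beta>\<^sup>2 * \<delta>))) \<le> real n * \<psi> / 2" .
  \<comment> \<open>This is exactly the difference of the two sides of the next inequality.\<close>
  have "0 \<le> \<beta> / 2 * (1 - \<beta>)\<^sup>2"
    using \<beta> by simp
  then have "1 - \<beta> \<le> (1 - \<beta>\<^sup>2) * (1 - \<beta> / 2)"
    by (simp add: power2_eq_square field_simps)
  also have "\<dots> \<le> (1 - \<beta>\<^sup>2) * (1 - exp (- real n * \<psi> / 8))"
    using tail \<beta>2 by (intro mult_left_mono) auto
  also have "\<dots> \<le> prob_run (planted_measure n \<psi>) (deviating_algorithm H pick)
         (\<lambda>S h. \<bar>empirical_value n S h - expected_value n (planted_measure n \<psi>) h\<bar> \<ge> \<psi> / 2)"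
    by (rule prob_run_deviating_ge[OF H pick n0 \<psi> \<beta>2 c])
  \<comment> \<open>Strictness comes from the positive exponential being subtracted.\<close>
  finally show "1 - \<beta> - exp (- real n / 8) < prob_run (planted_measure n \<psi>) (deviating_algorithm H pick)
         (\<lambda>S h. \<bar>empirical_value n S h - expected_value n (planted_measure n \<psi>) h\<bar> \<ge> \<psi> / 2)"
    using exp_gt_zero[of "- real n / 8"] by linarith
qed

end
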